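(* Let $P$ be an irreducible $N\times N$ real matrix with non-negative entries and spectral radius $\rho(P)=1$. Let $e=\frac1N(1,\dots,1)^T$ and let $\mathcal{I}=\mathcal{I}^+$ be a fair positive-diffusion sequence for $(P,Pe-e)$ (defined in the context). Then the D-iteration history vectors $H_n(P,Pe-e,\mathcal{I})$ converge, as $n\to\infty$, to $X-e$, where $X$ is the real right eigenvector of $P$ for the eigenvalue $1$ with $\min_i x_i=1/N$.
   Context: Let $\Omega=\{1,\dots,N\}$, let $I$ be the $N\times N$ identity matrix, and let $J_i$ be the matrix whose only non-zero entry is $(J_i)_{ii}=1$. The diffusion operators of $P$ are $P_i=I-J_i+PJ_i$. Given $B\in\mathbb{R}^N$ and a sequence $\mathcal{I}=\{i_1,i_2,\dots\}$ in $\Omega$, the D-iteration is $F_0=B$, $H_0=0$ and, for $n\ge1$, $F_n=P_{i_n}F_{n-1}$, $H_n=H_{n-1}+J_{i_n}F_{n-1}$; one writes $H_n=H_n(P,B,\mathcal{I})$. Let $\Omega_n^+=\{i\in\Omega:(F_n)_i\ge0\}$ and $\Omega^+=\bigcup_{n}\Omega_n^+$. A sequence $\mathcal{I}$ is a fair positive-diffusion sequence, written $\mathcal{I}^+$, if at each step only a node with non-negative fluid is diffused, i.e. $(F_{n-1})_{i_n}\ge0$ for all $n\ge1$, and every element of $\Omega^+$ occurs infinitely often in $\mathcal{I}$. *)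

theory Defs
  imports "HOL-Analysis.Analysis"
begin

text \<open>
  The index set of size \<open>N\<close> is a finite type \<open>'n\<close>, so that \<open>N = CARD('n)\<close>.
\<close>

definition is_eigenvector :: "'a::field ^ 'n ^ 'n \<Rightarrow> 'a ^ 'n \<Rightarrow> 'a \<Rightarrow> bool" where
  "is_eigenvector A v c \<longleftrightarrow> v \<noteq> 0 \<and> A *v v = c *s v"

text \<open>
  The eigenvalues are the complex ones. They form a nonempty finite set, so the
  supremum is a maximum.
\<close>

definition spectral_radius :: "real ^ 'n ^ 'n \<Rightarrow> real" where
  "spectral_radius A =
     Sup {cmod c | c. \<exists>v. is_eigenvector (map_matrix complex_of_real A) v c}"

text \<open>
  Irreducibility means that the directed graph of the nonzero entries is strongly connected.
  The transitive (not reflexive) closure makes the \<open>1 \<times> 1\<close> zero matrix reducible.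
\<close>

definition irreducible_matrix :: "'a::zero ^ 'n ^ 'n \<Rightarrow> bool" where
  "irreducible_matrix A \<longleftrightarrow> (\<forall>i j. (i, j) \<in> {(a, b). A $ a $ b \<noteq> 0}\<^sup>+)"

definition diag_unit :: "'n \<Rightarrow> real ^ 'n ^ 'n" where
  "diag_unit i = (\<chi> a b. if a = i \<and> b = i then 1 else 0)"

definition diffusion_op :: "real ^ 'n ^ 'n \<Rightarrow> 'n \<Rightarrow> real ^ 'n ^ 'n" where
  "diffusion_op P i = mat 1 - diag_unit i + P ** diag_unit i"

text \<open>
  A diffusion sequence \<open>i\<^sub>1, i\<^sub>2, \<dots>\<close> is a function on \<open>nat\<close> whose value at \<open>0\<close> is never used.
\<close>

primrec fluid :: "real ^ 'n ^ 'n \<Rightarrow> real ^ 'n \<Rightarrow> (nat \<Rightarrow> 'n) \<Rightarrow> nat \<Rightarrow> real ^ 'n" where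
  "fluid P B s 0 = B"
| "fluid P B s (Suc n) = diffusion_op P (s (Suc n)) *v fluid P B s n"

primrec history :: "real ^ 'n ^ 'n \<Rightarrow> real ^ 'n \<Rightarrow> (nat \<Rightarrow> 'n) \<Rightarrow> nat \<Rightarrow> real ^ 'n" where
  "history P B s 0 = 0"
| "history P B s (Suc n) = history P B s n + diag_unit (s (Suc n)) *v fluid P B s n"

definition nonneg_nodes :: "real ^ 'n ^ 'n \<Rightarrow> real ^ 'n \<Rightarrow> (nat \<Rightarrow> 'n) \<Rightarrow> 'n set" where
  "nonneg_nodes P B s = (\<Union>n. {i. fluid P B s n $ i \<ge> 0})"

definition fair_positive_diffusion ::
    "real ^ 'n ^ 'n \<Rightarrow> real ^ 'n \<Rightarrow> (nat \<Rightarrow> 'n) \<Rightarrow> bool" where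
  "fair_positive_diffusion P B s \<longleftrightarrow>
     (\<forall>n\<ge>1. fluid P B s (n - 1) $ s n \<ge> 0) \<and>
     (\<forall>i \<in> nonneg_nodes P B s. infinite {n. n \<ge> 1 \<and> s n = i})"

end

theory Submission
  imports Defs
begin

text \<open>
  Put \<open>X\<^sub>n = e + H\<^sub>n\<close>. The conservation law \<open>F\<^sub>n = P X\<^sub>n - X\<^sub>n\<close> shows that diffusing node \<open>i\<close> is a
  relaxation step: it replaces the coordinate \<open>i\<close> of \<open>X\<^sub>n\<close> by that of \<open>P X\<^sub>n\<close>. Let \<open>v\<close> be the Perron
  vector of \<open>P\<close>, scaled so that its smallest entry is \<open>1/N\<close>, hence \<open>e \<le> v = P v\<close>.

  Diffusing only non-negative fluid makes \<open>X\<^sub>n\<close> increase, and \<open>X\<^sub>n \<le> v\<close> is preserved by each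
  relaxation step because \<open>P\<close> is monotone. So \<open>X\<^sub>n\<close> converges to some \<open>X\<close> with \<open>e \<le> X \<le> v\<close>, and the
  smallest entry of \<open>X\<close> is again \<open>1/N\<close>, attained where \<open>v\<close> attains it. At a node that is diffused infinitely often the limit
  satisfies \<open>(P X)\<^sub>i = X\<^sub>i\<close>; by fairness every other node always carries negative fluid, which gives
  \<open>(P X)\<^sub>i \<le> X\<^sub>i\<close>. Hence \<open>P X \<le> X\<close>. For an irreducible matrix such an \<open>X\<close> is a multiple of \<open>v\<close>
  (\<open>superharmonic_is_multiple\<close>), which makes it an eigenvector; the same rigidity shows that the
  normalised eigenvector is unique.

  The Perron vector comes from Brouwer's theorem, applied on the standard simplex to \<open>x \<mapsto> P x\<close>
  rescaled to coordinate sum \<open>1\<close>. Its eigenvalue dominates the modulus of every complex eigenvalue,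
  so it is the spectral radius.
\<close>

section \<open>Nonnegative irreducible matrices\<close>

lemma matrix_vector_mult_nth: "(A *v x) $ i = (\<Sum>j\<in>UNIV. A $ i $ j * x $ j)"
  by (simp add: matrix_vector_mult_def)

lemma nonneg_matrix_vector_mono:
  fixes P :: "real ^ 'n ^ 'n"
  assumes "\<And>i j. P $ i $ j \<ge> 0" and "\<And>i. x $ i \<le> y $ i"
  shows "(P *v x) $ i \<le> (P *v y) $ i"
  unfolding matrix_vector_mult_nth by (intro sum_mono mult_left_mono assms)

text \<open>
  If \<open>w\<close> vanishes at \<open>a\<close>, the inequality at \<open>a\<close> bounds a sum of non-negative terms by \<open>0\<close>, so \<open>w\<close>
  vanishes at all successors of \<open>a\<close> in the graph of \<open>P\<close>. Strong connectivity spreads the zero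
  everywhere. This is a strong minimum principle.
\<close>

lemma irreducible_zero_spreads:
  fixes P :: "real ^ 'n ^ 'n"
  assumes irr: "irreducible_matrix P" and nonneg: "\<And>i j. P $ i $ j \<ge> 0"
    and w: "\<And>i. w $ i \<ge> 0" and le: "\<And>i. (P *v w) $ i \<le> c * w $ i"
    and zero: "w $ k = 0"
  shows "w = 0"
proof -
  have step: "w $ b = 0" if "w $ a = 0" "P $ a $ b \<noteq> 0" for a b
  proof -
    have nn: "P $ a $ j * w $ j \<ge> 0" for j
      using nonneg w by simp
    have "(\<Sum>j\<in>UNIV. P $ a $ j * w $ j) \<le> 0"
      using le[of a] that by (simp add: matrix_vector_mult_nth)
    then have "(\<Sum>j\<in>UNIV. P $ a $ j * w $ j) = 0"
      by (intro antisym sum_nonneg nn)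
    then have "P $ a $ b * w $ b = 0"
      by (simp add: sum_nonneg_eq_0_iff nn)
    with that show ?thesis by simp
  qed
  have "w $ i = 0" for i
  proof -
    have "(k, i) \<in> {(a, b). P $ a $ b \<noteq> 0}\<^sup>+"
      using irr by (simp add: irreducible_matrix_def)
    then show ?thesis
      by (induction rule: trancl_induct) (auto intro: step[OF zero] step)
  qed
  then show ?thesis by (simp add: vec_eq_iff)
qed

lemma touching_multiple_below:
  fixes v :: "real ^ 'n"
  assumes "\<And>i. v $ i > 0"
  obtains t k where "\<And>i. t * v $ i \<le> y $ i" and "y $ k = t * v $ k"
proof -
  let ?r = "\<lambda>i. y $ i / v $ i"
  have "Min (range ?r) \<in> range ?r" by (intro Min_in) auto
  then obtain k where k: "Min (range ?r) = ?r k" by (rule rangeE)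
  have "?r k * v $ i \<le> y $ i" for i
  proof -
    have "?r k \<le> ?r i"
      unfolding k[symmetric] by simp
    then show ?thesis
      using assms[of i] by (simp only: pos_le_divide_eq)
  qed
  moreover have "y $ k = ?r k * v $ k"
    using assms[of k] by simp
  ultimately show thesis using that by blast
qed

text \<open>
  Slide the multiples of \<open>v\<close> up until one touches \<open>y\<close> from below. The difference is non-negative,
  superharmonic and vanishes at the contact point, so it vanishes identically.
\<close>

lemma superharmonic_is_multiple:
  fixes P :: "real ^ 'n ^ 'n"
  assumes irr: "irreducible_matrix P" and nonneg: "\<And>i j. P $ i $ j \<ge> 0"
    and vpos: "\<And>i. v $ i > 0" and v: "P *v v = v"
    and super: "\<And>i. (P *v y) $ i \<le> y $ i"
  obtains t where "y = t *s v"
proof -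
  obtain t k where below: "\<And>i. t * v $ i \<le> y $ i" and k: "y $ k = t * v $ k"
    using touching_multiple_below[OF vpos] by blast
  have "y - t *s v = 0"
  proof (rule irreducible_zero_spreads[OF irr nonneg])
    show "(y - t *s v) $ i \<ge> 0" for i
      using below by simp
    show "(P *v (y - t *s v)) $ i \<le> 1 * (y - t *s v) $ i" for i
      using super[of i] by (simp add: matrix_vector_mult_diff_distrib vector_scalar_commute v)
    show "(y - t *s v) $ k = 0"
      using k by simp
  qed
  then show thesis by (intro that[of t]) simp
qed

section \<open>The Perron vector\<close>

text \<open>
  Strong connectivity gives every column a non-zero entry, so no weight is lost entirely. This is
  what keeps the rescaled map \<open>x \<mapsto> P x\<close> well defined on the whole simplex.
\<close>

lemma irreducible_mult_eq_zero:
  fixes P :: "real ^ 'n ^ 'n"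
  assumes irr: "irreducible_matrix P" and nonneg: "\<And>i j. P $ i $ j \<ge> 0"
    and x: "\<And>i. x $ i \<ge> 0" and zero: "P *v x = 0"
  shows "x = 0"
proof -
  have "x $ b = 0" for b
  proof -
    have "(b, b) \<in> {(a, b). P $ a $ b \<noteq> 0}\<^sup>+"
      using irr by (simp add: irreducible_matrix_def)
    then obtain a where a: "P $ a $ b \<noteq> 0"
      by (auto dest: tranclD2)
    have "(\<Sum>j\<in>UNIV. P $ a $ j * x $ j) = 0"
      using zero by (metis matrix_vector_mult_nth zero_index)
    then have "P $ a $ b * x $ b = 0"
      by (simp add: sum_nonneg_eq_0_iff nonneg x)
    with a show ?thesis by simp
  qed
  then show ?thesis by (simp add: vec_eq_iff)
qed

text \<open>
  A fixed point of the rescaled map is an eigenvector with non-negative entries; since it is not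
  zero, the strong minimum principle makes all of its entries positive.
\<close>

lemma perron_vector_exists:
  fixes P :: "real ^ 'n ^ 'n"
  assumes irr: "irreducible_matrix P" and nonneg: "\<And>i j. P $ i $ j \<ge> 0"
  obtains x r where "\<And>i. x $ i > 0" and "r \<ge> 0" and "P *v x = r *s x"
proof -
  define S where "S = {x :: real ^ 'n. (\<forall>i. 0 \<le> x $ i) \<and> (\<Sum>i\<in>UNIV. x $ i) = 1}"
  define \<sigma> where "\<sigma> = (\<lambda>x. \<Sum>i\<in>UNIV. (P *v x) $ i)"
  define f where "f = (\<lambda>x. (1 / \<sigma> x) *s (P *v x))"
  have Px: "(P *v x) $ i \<ge> 0" if "x \<in> S" for x i
    using that nonneg by (auto simp: S_def matrix_vector_mult_nth intro!: sum_nonneg)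
  have \<sigma>pos: "\<sigma> x > 0" if "x \<in> S" for x
  proof -
    have "x \<noteq> 0" using that by (auto simp: S_def)
    then have "P *v x \<noteq> 0"
      using irreducible_mult_eq_zero[OF irr nonneg, of x] that by (auto simp: S_def)
    then have "\<sigma> x \<noteq> 0"
      unfolding \<sigma>_def using Px[OF that]
      by (simp add: sum_nonneg_eq_0_iff vec_eq_iff)
    moreover have "\<sigma> x \<ge> 0" unfolding \<sigma>_def using Px[OF that] by (intro sum_nonneg)
    ultimately show ?thesis by simp
  qed
  have "compact S"
  proof (rule compact_eq_bounded_closed[THEN iffD2], intro conjI)
    have "S \<subseteq> cbox 0 1"
    proof
      fix x assume "x \<in> S"
      then have x: "0 \<le> x $ i" "(\<Sum>i\<in>UNIV. x $ i) = 1" for i by (auto simp: S_def)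
      have "x $ i \<le> (\<Sum>i\<in>UNIV. x $ i)" for i
        using x by (intro member_le_sum) auto
      with x show "x \<in> cbox 0 1" by (simp add: mem_box_cart)
    qed
    then show "bounded S" using bounded_cbox bounded_subset by blast
    have "S = (\<Inter>i. {x. 0 \<le> x $ i}) \<inter> {x. (\<Sum>i\<in>UNIV. x $ i) = 1}"
      by (auto simp: S_def)
    also have "closed \<dots>"
      by (intro closed_Int closed_INT ballI closed_Collect_le closed_Collect_eq continuous_intros)
    finally show "closed S" .
  qed
  moreover have "convex S"
    unfolding convex_def S_def
    by (auto simp: sum.distrib simp flip: sum_distrib_left)
  moreover have "S \<noteq> {}"
  proof -
    have "vec (1 / real CARD('n)) \<in> S" by (simp add: S_def)
    then show ?thesis by blast
  qed
  moreover have "continuous_on S f"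
  proof -
    have "\<sigma> x \<noteq> 0" if "x \<in> S" for x using \<sigma>pos[OF that] by simp
    then show ?thesis
      unfolding f_def scalar_mult_eq_scaleR \<sigma>_def
      by (intro continuous_intros) auto
  qed
  moreover have "f \<in> S \<rightarrow> S"
  proof
    fix x assume x: "x \<in> S"
    have "(\<Sum>i\<in>UNIV. f x $ i) = \<sigma> x / \<sigma> x"
      by (simp add: f_def \<sigma>_def flip: sum_divide_distrib)
    then have "(\<Sum>i\<in>UNIV. f x $ i) = 1"
      using \<sigma>pos[OF x] by simp
    then show "f x \<in> S"
      using \<sigma>pos[OF x] Px[OF x] by (simp add: S_def f_def)
  qed
  ultimately obtain x where xS: "x \<in> S" and fx: "f x = x"
    by (rule brouwer)
  have "P *v x = \<sigma> x *s f x"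
    using \<sigma>pos[OF xS] by (simp add: f_def vec_eq_iff)
  then have eig: "P *v x = \<sigma> x *s x" by (simp add: fx)
  have nn: "x $ i \<ge> 0" for i using xS by (simp add: S_def)
  have "x \<noteq> 0" using xS by (auto simp: S_def)
  then have "x $ i \<noteq> 0" for i
    using irreducible_zero_spreads[OF irr nonneg nn, of "\<sigma> x" i] eig by auto
  then have "x $ i > 0" for i
    using nn[of i] by (simp add: less_le)
  then show thesis
    using that eig \<sigma>pos[OF xS] by (meson less_imp_le)
qed

text \<open>
  For a complex eigenvector \<open>z\<close>, the vector \<open>\<bar>z\<bar>\<close> of moduli satisfies \<open>\<bar>c\<bar> \<bar>z\<bar> \<le> P \<bar>z\<bar>\<close>. Comparing it
  with the smallest multiple of \<open>x\<close> above \<open>\<bar>z\<bar>\<close> at a point of contact gives the bound.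
\<close>

lemma eigenvalue_le_perron:
  fixes P :: "real ^ 'n ^ 'n"
  assumes nonneg: "\<And>i j. P $ i $ j \<ge> 0"
    and xpos: "\<And>i. x $ i > 0" and eig: "P *v x = r *s x"
    and z: "is_eigenvector (map_matrix complex_of_real P) z c"
  shows "cmod c \<le> r"
proof -
  define m where "m = (\<chi> i. cmod (z $ i))"
  have sub: "cmod c * m $ i \<le> (P *v m) $ i" for i
  proof -
    have "c * z $ i = (\<Sum>j\<in>UNIV. of_real (P $ i $ j) * z $ j)"
      using z by (simp add: is_eigenvector_def vec_eq_iff matrix_vector_mult_nth map_matrix_def)
    then have "cmod c * m $ i = cmod (\<Sum>j\<in>UNIV. of_real (P $ i $ j) * z $ j)"
      by (simp add: m_def flip: norm_mult)
    also have "\<dots> \<le> (\<Sum>j\<in>UNIV. P $ i $ j * m $ j)"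
      by (rule order.trans[OF norm_sum]) (simp add: m_def norm_mult nonneg)
    finally show ?thesis by (simp add: matrix_vector_mult_nth)
  qed
  obtain t k where below: "\<And>i. t * x $ i \<le> (- m) $ i" and k: "(- m) $ k = t * x $ k"
    using touching_multiple_below[OF xpos] by blast
  have above: "m $ i \<le> ((-t) *s x) $ i" for i
    using below[of i] by simp
  have "m $ k \<noteq> 0"
  proof
    assume "m $ k = 0"
    then have "t = 0" using k xpos[of k] by simp
    then have "m $ i \<le> 0" for i using above[of i] by simp
    then have "z = 0" by (simp add: m_def vec_eq_iff)
    then show False using z by (simp add: is_eigenvector_def)
  qed
  then have mk: "m $ k > 0" by (simp add: m_def)
  have "cmod c * m $ k \<le> (P *v m) $ k" by (rule sub)
  also have "\<dots> \<le> (P *v ((-t) *s x)) $ k"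
    by (rule nonneg_matrix_vector_mono[OF nonneg above])
  also have "P *v ((-t) *s x) = (-t) *s (r *s x)"
    by (simp only: vector_scalar_commute eig)
  also have "((-t) *s (r *s x)) $ k = r * m $ k"
  proof -
    have "m $ k = - t * x $ k" using k by simp
    then show ?thesis by simp
  qed
  finally show ?thesis using mk by simp
qed

lemma spectral_radius_eq_perron:
  fixes P :: "real ^ 'n ^ 'n"
  assumes nonneg: "\<And>i j. P $ i $ j \<ge> 0"
    and xpos: "\<And>i. x $ i > 0" and "r \<ge> 0" and eig: "P *v x = r *s x"
  shows "spectral_radius P = r"
proof -
  let ?z = "\<chi> i. complex_of_real (x $ i)"
  have "(\<Sum>j\<in>UNIV. P $ i $ j * x $ j) = r * x $ i" for i
    using eig by (metis matrix_vector_mult_nth vector_smult_component)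
  then have "(\<Sum>j\<in>UNIV. complex_of_real (P $ i $ j) * of_real (x $ j)) = of_real r * of_real (x $ i)" for i
    by (simp flip: of_real_mult of_real_sum)
  moreover have "?z \<noteq> 0"
    using xpos by (auto simp: vec_eq_iff less_le)
  ultimately have "is_eigenvector (map_matrix complex_of_real P) ?z (of_real r)"
    by (simp add: is_eigenvector_def vec_eq_iff matrix_vector_mult_nth map_matrix_def)
  moreover have "r = cmod (of_real r)" using \<open>r \<ge> 0\<close> by simp
  ultimately have "r \<in> {cmod c | c. \<exists>v. is_eigenvector (map_matrix complex_of_real P) v c}"
    by blast
  then show ?thesis
    unfolding spectral_radius_def
    using eigenvalue_le_perron[OF nonneg xpos eig] by (intro cSup_eq_maximum) blast+
qed

lemma normalised_perron_vector:
  fixes P :: "real ^ 'n ^ 'n"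
  assumes "irreducible_matrix P" and "\<And>i j. P $ i $ j \<ge> 0"
    and "spectral_radius P = 1" and "m > 0"
  obtains v k where "P *v v = v" and "\<And>i. m \<le> v $ i" and "v $ k = m"
proof -
  obtain x r where xpos: "\<And>i. x $ i > 0" and "r \<ge> 0" and eig: "P *v x = r *s x"
    using perron_vector_exists[OF assms(1,2)] by blast
  have "r = 1"
    using spectral_radius_eq_perron[OF assms(2) xpos \<open>r \<ge> 0\<close> eig] assms(3) by simp
  obtain t k where t: "\<And>i. t * vec 1 $ i \<le> x $ i" and k: "x $ k = t * vec 1 $ k"
    using touching_multiple_below[of "vec 1"] by (metis vec_component zero_less_one)
  have "t > 0" using k xpos[of k] by simp
  show thesis
  proof (rule that)
    show "P *v ((m / t) *s x) = (m / t) *s x"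
      by (simp add: vector_scalar_commute eig \<open>r = 1\<close>)
    show "m \<le> ((m / t) *s x) $ i" for i
      using t[of i] \<open>t > 0\<close> \<open>m > 0\<close> by (simp add: field_simps)
    show "((m / t) *s x) $ k = m"
      using k \<open>t > 0\<close> by simp
  qed
qed

section \<open>Diffusion as monotone relaxation\<close>

lemma diag_unit_mult: "diag_unit i *v x = axis i (x $ i)"
proof -
  have "(\<Sum>j\<in>UNIV. (if a = i \<and> j = i then 1 else 0) * x $ j) = (if a = i then x $ i else 0)" for a
    by (cases "a = i") (simp_all add: if_distrib[of "\<lambda>c. c * _"] cong: if_cong)
  then show ?thesis
    by (simp add: vec_eq_iff matrix_vector_mult_nth diag_unit_def axis_def)
qed

lemma diffusion_op_mult:
  "diffusion_op P i *v x = x - diag_unit i *v x + P *v (diag_unit i *v x)"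
  by (simp add: diffusion_op_def matrix_vector_mult_add_rdistrib matrix_vector_mult_diff_rdistrib
      matrix_vector_mul_assoc)

lemma fluid_conservation:
  "fluid P (P *v e - e) s n
     = P *v (e + history P (P *v e - e) s n) - (e + history P (P *v e - e) s n)"
  by (induction n)
    (simp_all add: diffusion_op_mult matrix_vector_right_distrib algebra_simps)

text \<open>
  By conservation, the fluid at a node is exactly what its coordinate misses to agree with its
  image under \<open>P\<close>.
\<close>

lemma history_relaxation:
  fixes P :: "real ^ 'n ^ 'n" and e :: "real ^ 'n" and s :: "nat \<Rightarrow> 'n"
  defines "X \<equiv> \<lambda>n. e + history P (P *v e - e) s n"
  shows "X (Suc n) $ i = (if i = s (Suc n) then (P *v X n) $ i else X n $ i)"
proof -
  have "fluid P (P *v e - e) s n = P *v X n - X n"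
    unfolding X_def by (rule fluid_conservation)
  moreover have "X (Suc n) = X n + axis (s (Suc n)) (fluid P (P *v e - e) s n $ s (Suc n))"
    by (simp add: X_def diag_unit_mult)
  ultimately show ?thesis
    by (simp add: axis_def)
qed

text \<open>
  A fixed point \<open>v\<close> above the starting vector acts as a barrier for the increasing iteration.
  Fairness enters only in the last bound, which says that no positive fluid is left over in the
  limit.
\<close>

lemma fair_positive_diffusion_converges:
  fixes P :: "real ^ 'n ^ 'n" and e :: "real ^ 'n"
  assumes nonneg: "\<And>i j. P $ i $ j \<ge> 0"
    and fair: "fair_positive_diffusion P (P *v e - e) s"
    and v: "P *v v = v" and ev: "\<And>i. e $ i \<le> v $ i"
  obtains X where "(\<lambda>n. e + history P (P *v e - e) s n) \<longlonglongrightarrow> X"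
    and "\<And>i. e $ i \<le> X $ i" and "\<And>i. X $ i \<le> v $ i"
    and "\<And>i. (P *v X) $ i \<le> X $ i"
proof -
  define Z where "Z = (\<lambda>n. e + history P (P *v e - e) s n)"
  have fluid: "fluid P (P *v e - e) s n = P *v Z n - Z n" for n
    unfolding Z_def by (rule fluid_conservation)
  have relax: "Z (Suc n) $ i = (if i = s (Suc n) then (P *v Z n) $ i else Z n $ i)" for n i
    unfolding Z_def by (rule history_relaxation)
  have "fluid P (P *v e - e) s n $ s (Suc n) \<ge> 0" for n
    using fair unfolding fair_positive_diffusion_def
    by (metis diff_Suc_1 le_add1 plus_1_eq_Suc)
  then have up: "Z n $ s (Suc n) \<le> (P *v Z n) $ s (Suc n)" for n
    by (simp add: fluid)
  have inc: "incseq (\<lambda>n. Z n $ i)" for i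
    by (intro incseq_SucI) (use up in \<open>auto simp: relax\<close>)
  have below: "Z n $ i \<le> v $ i" for n i
  proof (induction n arbitrary: i)
    case 0
    show ?case by (simp add: Z_def ev)
  next
    case (Suc n)
    have "(P *v Z n) $ i \<le> (P *v v) $ i"
      using nonneg Suc by (rule nonneg_matrix_vector_mono)
    then show ?case by (auto simp: relax v Suc)
  qed
  have "\<exists>l. (\<lambda>n. Z n $ i) \<longlonglongrightarrow> l" for i
    using incseq_convergent[OF inc] below by metis
  then obtain x where x: "\<And>i. (\<lambda>n. Z n $ i) \<longlonglongrightarrow> x i" by metis
  define X where "X = (\<chi> i. x i)"
  have lim: "Z \<longlonglongrightarrow> X"
    by (rule vec_tendstoI) (simp add: X_def x)
  then have limi: "(\<lambda>n. Z n $ i) \<longlonglongrightarrow> X $ i" for i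
    by (rule tendsto_vec_nth)
  have limP: "(\<lambda>n. (P *v Z n) $ i) \<longlonglongrightarrow> (P *v X) $ i" for i
    unfolding matrix_vector_mult_nth by (intro tendsto_intros limi)
  have "(P *v X) $ i \<le> X $ i" for i
  proof (cases "i \<in> nonneg_nodes P (P *v e - e) s")
    case True
    \<comment> \<open>When \<open>i\<close> is diffused at step \<open>k + 1\<close>, \<open>(P Z\<^sub>k)\<^sub>i\<close> becomes a coordinate of the iterate and so
      stays below the limit; monotonicity extends this bound to the indices between such steps.\<close>
    have "infinite {n. n \<ge> 1 \<and> s n = i}"
      using True fair by (simp add: fair_positive_diffusion_def)
    then have "\<exists>n\<ge>Suc m. s n = i" for m
      unfolding infinite_nat_iff_unbounded_le by auto
    then have often: "\<exists>n\<ge>m. s (Suc n) = i" for m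
      by (metis Suc_le_D Suc_le_mono)
    have "(P *v Z n) $ i \<le> X $ i" for n
    proof -
      obtain k where k: "k \<ge> n" "s (Suc k) = i" using often by blast
      have "(P *v Z n) $ i \<le> (P *v Z k) $ i"
        by (intro nonneg_matrix_vector_mono nonneg incseqD[OF inc] k)
      also have "\<dots> = Z (Suc k) $ i" by (simp add: relax k)
      also have "\<dots> \<le> X $ i" by (rule incseq_le[OF inc limi])
      finally show ?thesis .
    qed
    then show ?thesis by (intro LIMSEQ_le_const2[OF limP]) auto
  next
    case False
    then have "fluid P (P *v e - e) s n $ i < 0" for n
      by (auto simp: nonneg_nodes_def not_le)
    then have "(P *v Z n) $ i \<le> Z n $ i" for n
      by (simp add: fluid less_imp_le)
    then show ?thesis by (intro LIMSEQ_le[OF limP limi]) auto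
  qed
  moreover have "e $ i \<le> X $ i" for i
    using incseq_le[OF inc limi, of 0 i] by (simp add: Z_def)
  moreover have "X $ i \<le> v $ i" for i
    by (rule LIMSEQ_le_const2[OF limi]) (use below in auto)
  ultimately show thesis
    using that lim unfolding Z_def by blast
qed

section \<open>Convergence to the normalised eigenvector\<close>

theorem theorem7:
  fixes P :: "real ^ 'n ^ 'n" and e :: "real ^ 'n" and s :: "nat \<Rightarrow> 'n"
  assumes "irreducible_matrix P"
    and "\<And>i j. P $ i $ j \<ge> 0"
    and "spectral_radius P = 1"
    and "e = vec (1 / real CARD('n))"
    and "fair_positive_diffusion P (P *v e - e) s"
  shows "\<exists>X. is_eigenvector P X 1 \<and> Min (range (($) X)) = 1 / real CARD('n) \<and>
           (\<forall>Y. is_eigenvector P Y 1 \<and> Min (range (($) Y)) = 1 / real CARD('n) \<longrightarrow> Y = X) \<and>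
           (\<lambda>n. history P (P *v e - e) s n) \<longlonglongrightarrow> X - e"
proof -
  define m where "m = 1 / real CARD('n)"
  have "m > 0" by (simp add: m_def)
  have e: "e $ i = m" for i by (simp add: assms(4) m_def)
  obtain v k where v: "P *v v = v" and vm: "\<And>i. m \<le> v $ i" and vk: "v $ k = m"
    using normalised_perron_vector[OF assms(1-3) \<open>m > 0\<close>] by blast
  have vpos: "v $ i > 0" for i
    using vm[of i] \<open>m > 0\<close> by linarith
  have Min_v: "Min (range (($) v)) = m"
    by (intro Min_eqI) (use vm vk in auto)
  \<comment> \<open>A superharmonic vector with smallest entry \<open>m\<close> is \<open>v\<close>: it is \<open>t v\<close> for some \<open>t\<close>,
    and comparing smallest entries gives \<open>t = 1\<close>.\<close>
  have unique: "y = v" if super: "\<And>i. (P *v y) $ i \<le> y $ i" and Min_y: "Min (range (($) y)) = m" for y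
  proof -
    obtain t where t: "y = t *s v"
      using superharmonic_is_multiple[OF assms(1,2) vpos v super] by blast
    have "Min (range (($) y)) \<in> range (($) y)" by (intro Min_in) auto
    then obtain j where j: "y $ j = m" unfolding Min_y by auto
    have "m \<le> y $ k" unfolding Min_y[symmetric] by simp
    then have "1 \<le> t" using t vk \<open>m > 0\<close> by simp
    moreover have "t * v $ j \<le> 1 * v $ j"
      using j t vm[of j] by simp
    ultimately have "t = 1"
      using vpos[of j] by simp
    with t show ?thesis by simp
  qed
  have "\<And>i. e $ i \<le> v $ i" using vm by (simp add: e)
  then obtain X where lim: "(\<lambda>n. e + history P (P *v e - e) s n) \<longlonglongrightarrow> X"
    and eX: "\<And>i. e $ i \<le> X $ i" and Xv: "\<And>i. X $ i \<le> v $ i"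
    and super: "\<And>i. (P *v X) $ i \<le> X $ i"
    using fair_positive_diffusion_converges[OF assms(2,5) v] by blast
  have "X $ k = m"
    using eX[of k] Xv[of k] by (simp add: e vk)
  then have "Min (range (($) X)) = m"
    by (intro Min_eqI) (use eX e in auto)
  then have "X = v"
    using unique super by blast
  moreover have "(\<lambda>n. history P (P *v e - e) s n) \<longlonglongrightarrow> X - e"
    using tendsto_diff[OF lim tendsto_const[of e]] by simp
  moreover have "is_eigenvector P v 1"
    using v vpos by (auto simp: is_eigenvector_def vec_eq_iff less_le)
  moreover have "Y = v" if "is_eigenvector P Y 1" "Min (range (($) Y)) = m" for Y
    using that by (intro unique) (simp_all add: is_eigenvector_def)
  ultimately show ?thesis
    using Min_v unfolding m_def by blast
qed

end
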